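(* Let $z = (z_0, z_1) \in \mathbb{R} \times \mathbb{R}^{n-1}$, let $\alpha \in \{1, -1\}$ and $c \in \mathbb{R}$, and let $\mathcal{K} = \mathcal{K}_\alpha(c) = \{ (y_0, y_1) \in \mathbb{R} \times \mathbb{R}^{n-1} : \|y_1\| \leq \alpha (y_0 - c) \} \subset \mathbb{R}^n$. Then the Euclidean projection of $z$ onto $\mathcal{K}$ is given by $$ \mathcal{P}_{\mathcal{K}}(z) = \begin{cases} z & \text{if } \|z_1\| \leq \alpha (z_0 - c), \\ (c, 0) & \text{if } \|z_1\| \leq -\alpha (z_0 - c), \\ \left( \tau \alpha + c, \; \dfrac{\tau z_1}{\|z_1\|} \right) & \text{otherwise,} \end{cases} $$ where $\tau = \frac{1}{2} \left( \alpha (z_0 - c) + \|z_1\| \right)$.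
   Context: $\|\cdot\|$ denotes the standard Euclidean norm. $\mathbb{R}^n$ is identified with $\mathbb{R} \times \mathbb{R}^{n-1}$, and vectors are written $z = (z_0, z_1)$ with $z_0 \in \mathbb{R}$ and $z_1 \in \mathbb{R}^{n-1}$. The set $\mathcal{K}_\alpha(c)$ is called a shifted second order cone. The Euclidean projection of $x \in \mathbb{R}^n$ onto a set $\mathcal{X} \subseteq \mathbb{R}^n$ is $\mathcal{P}_{\mathcal{X}}(x) = \arg\min_{v \in \mathcal{X}} \|v - x\|^2$. *)

theory Defs
  imports "HOL-Analysis.Analysis"
begin

definition shifted_soc :: "real \<Rightarrow> real \<Rightarrow> (real \<times> 'a::real_inner) set" where
  "shifted_soc \<alpha> c = {(y0, y1). norm y1 \<le> \<alpha> * (y0 - c)}"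

(* The full set of minimisers, so that P_X(x) = p reads "projection X x = {p}",
   which includes existence and uniqueness of the minimiser. On product types,
   norm is the Euclidean norm: norm (a, b) = sqrt ((norm a)^2 + (norm b)^2). *)
definition projection :: "'a::real_normed_vector set \<Rightarrow> 'a \<Rightarrow> 'a set" where
  "projection X x = {p. is_arg_min (\<lambda>v. (norm (v - x))\<^sup>2) (\<lambda>v. v \<in> X) p}"

(* R^d up to isometry, as a property of the type 'a. In contrast to the class
   euclidean_space and to real ^ 'd, the dimension d = 0 is allowed. *)
definition has_dimension :: "'a::real_inner itself \<Rightarrow> nat \<Rightarrow> bool" where
  "has_dimension (_ :: 'a itself) d \<longleftrightarrow>
     (\<exists>B :: 'a set. finite B \<and> independent B \<and> span B = UNIV \<and> card B = d)"

lemma has_dimension_euclidean_space: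
  "has_dimension TYPE('a::euclidean_space) DIM('a)"
  unfolding has_dimension_def
  using independent_Basis span_Basis finite_Basis by blast

end

(* A point p of X with inner (v - p) (x - p) \<le> 0 for all v in X is the unique nearest point to x.
   For the cone this variational inequality is checked in each case with Cauchy-Schwarz, writing
   s = \<alpha> * (y0 - c) and t = \<alpha> * (z0 - c), so that the cone is norm y1 \<le> s and products of first
   coordinates are unchanged because \<alpha>^2 = 1. *)
theory Submission
  imports Defs
begin

text \<open>Expanding the square around \<open>p\<close>, the cross term has the favourable sign, so
  moving from \<open>p\<close> to \<open>v\<close> raises the squared distance by at least
  \<open>(norm (v - p))\<^sup>2\<close>. This gives minimality and uniqueness together.\<close>

lemma projection_eq_singletonI:
  fixes x p :: "'a::real_inner"
  assumes "p \<in> X" and obtuse: "\<And>v. v \<in> X \<Longrightarrow> inner (v - p) (x - p) \<le> 0"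
  shows "projection X x = {p}"
proof -
  have gap: "(norm (p - x))\<^sup>2 + (norm (v - p))\<^sup>2 \<le> (norm (v - x))\<^sup>2" if "v \<in> X" for v
  proof -
    have "(norm (v - x))\<^sup>2 = (norm (p - x))\<^sup>2 + (norm (v - p))\<^sup>2 - 2 * inner (v - p) (x - p)"
      by (simp add: power2_norm_eq_inner inner_diff_left inner_diff_right inner_commute algebra_simps)
    then show ?thesis
      using obtuse[OF that] by simp
  qed
  have "(norm (p - x))\<^sup>2 \<le> (norm (v - x))\<^sup>2" if "v \<in> X" for v
    using gap[OF that] zero_le_power2[of "norm (v - p)"] by linarith
  moreover have "v = p" if "v \<in> X" "(norm (v - x))\<^sup>2 \<le> (norm (p - x))\<^sup>2" for v
  proof -
    have "(norm (v - p))\<^sup>2 \<le> 0"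
      using gap[OF that(1)] that(2) by linarith
    then show ?thesis by simp
  qed
  ultimately show ?thesis
    using \<open>p \<in> X\<close> unfolding projection_def is_arg_min_def by (force simp: not_less)
qed

theorem theorem1:
  fixes n :: nat and z0 :: real and z1 :: "'a::real_inner" and \<alpha> c :: real
  assumes "n \<ge> 1" and "has_dimension TYPE('a) (n - 1)"
    and "\<alpha> \<in> {1, -1}"
  shows "let \<tau> = 1 / 2 * (\<alpha> * (z0 - c) + norm z1) in
    projection (shifted_soc \<alpha> c) (z0, z1) =
      {if norm z1 \<le> \<alpha> * (z0 - c) then (z0, z1)
       else if norm z1 \<le> - \<alpha> * (z0 - c) then (c, 0)
       else (\<tau> * \<alpha> + c, (\<tau> *\<^sub>R z1) /\<^sub>R norm z1)}"
proof -
  define t r where "t = \<alpha> * (z0 - c)" and "r = norm z1"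
  define \<tau> where "\<tau> = 1 / 2 * (t + r)"
  have \<alpha>2: "\<alpha> * \<alpha> = 1"
    using assms(3) by auto
  have z0: "z0 = c + \<alpha> * t"
    using \<alpha>2 by (simp add: t_def flip: mult.assoc)
  have cone: "(c + \<alpha> * s, y) \<in> shifted_soc \<alpha> c \<longleftrightarrow> norm y \<le> s" for s and y :: 'a
    using \<alpha>2 by (simp add: shifted_soc_def flip: mult.assoc)
  have inner_\<alpha>: "inner (\<alpha> * a, u) (\<alpha> * b, v) = a * b + inner u v" for a b and u v :: 'a
  proof -
    have "(\<alpha> * a) * (\<alpha> * b) = (\<alpha> * \<alpha>) * (a * b)"
      by (simp only: ac_simps)
    then show ?thesis
      using \<alpha>2 by simp
  qed
  \<comment> \<open>Since \<alpha> is its own inverse, \<open>(s, y)\<close> \<mapsto>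
    \<open>(c + \<alpha> * s, y)\<close> is an isometry from the standard cone
    \<open>norm y \<le> s\<close> onto the shifted one, and it sends \<open>(t, z1)\<close> to
    \<open>(z0, z1)\<close>. The variational inequality can thus be checked in the standard cone,
    with candidate \<open>(q, w)\<close>.\<close>
  have projI: "projection (shifted_soc \<alpha> c) (z0, z1) = {(c + \<alpha> * q, w)}"
    if "norm w \<le> q"
      and *: "\<And>s y. norm y \<le> s \<Longrightarrow> (s - q) * (t - q) + inner (y - w) (z1 - w) \<le> 0"
    for q and w :: 'a
  proof (rule projection_eq_singletonI)
    show "(c + \<alpha> * q, w) \<in> shifted_soc \<alpha> c"
      using that(1) by (simp add: cone)
    fix v :: "real \<times> 'a"
    assume v: "v \<in> shifted_soc \<alpha> c"
    define s y where "s = \<alpha> * (fst v - c)" and "y = snd v"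
    have v_eq: "v = (c + \<alpha> * s, y)"
      using \<alpha>2 by (simp add: s_def y_def prod_eq_iff flip: mult.assoc)
    have "v - (c + \<alpha> * q, w) = (\<alpha> * (s - q), y - w)"
      and "(z0, z1) - (c + \<alpha> * q, w) = (\<alpha> * (t - q), z1 - w)"
      by (simp_all add: v_eq z0 algebra_simps)
    then show "inner (v - (c + \<alpha> * q, w)) ((z0, z1) - (c + \<alpha> * q, w)) \<le> 0"
      using *[of y s] v by (simp only: inner_\<alpha>) (simp add: v_eq cone)
  qed
  have cs: "inner y z1 \<le> s * r" if "norm y \<le> s" for s y
    using norm_cauchy_schwarz[of y z1] mult_right_mono[OF that, of r] by (simp add: r_def)
  consider "r \<le> t" | "\<not> r \<le> t" "r \<le> - t" | "\<not> r \<le> t" "\<not> r \<le> - t"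
    by blast
  then have "projection (shifted_soc \<alpha> c) (z0, z1) =
      {if r \<le> t then (z0, z1) else if r \<le> - t then (c, 0)
       else (\<tau> * \<alpha> + c, (\<tau> *\<^sub>R z1) /\<^sub>R r)}"
  proof cases
    case 1
    \<comment> \<open>The point lies in the cone and is its own candidate, so both summands
      vanish.\<close>
    then show ?thesis
      using projI[of z1 t] by (simp add: z0 r_def)
  next
    case 2
    \<comment> \<open>The candidate is the apex: \<open>(t, z1)\<close> lies in the polar
      cone.\<close>
    have "s * t + inner y z1 \<le> 0" if "norm y \<le> s" for s y
    proof -
      have "0 \<le> s"
        using that norm_ge_zero order_trans by blast
      then have "s * r \<le> s * (- t)"
        using 2 by (intro mult_left_mono)
      then show ?thesis
        using cs[OF that] by simp
    qed
    then show ?thesis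
      using projI[of 0 0] 2 by simp
  next
    case 3
    \<comment> \<open>Here \<open>r\<close> exceeds the absolute value of \<open>t\<close>, so
      \<open>z1\<close> is nonzero and the divisions by \<open>r\<close> are genuine.\<close>
    then have "r > 0" "\<tau> > 0"
      by (auto simp: \<tau>_def)
    define w where "w = (\<tau> / r) *\<^sub>R z1"
    \<comment> \<open>In the plane of \<open>(t, r)\<close>, split
      \<open>(t, r) = \<tau> (1, 1) + \<mu> (-1, 1)\<close>: the first part lies on the boundary ray
      of the cone, the second is the residual orthogonal to it.\<close>
    define \<mu> where "\<mu> = (r - t) / 2"
    have "\<mu> > 0"
      using 3 by (simp add: \<mu>_def)
    have t\<tau>: "t - \<tau> = - \<mu>" and r\<tau>: "r - \<tau> = \<mu>"
      by (simp_all add: \<tau>_def \<mu>_def field_simps)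
    have "z1 - w = (1 - \<tau> / r) *\<^sub>R z1"
      by (simp add: w_def algebra_simps)
    also have "1 - \<tau> / r = \<mu> / r"
      using \<open>r > 0\<close> r\<tau> by (simp add: field_simps)
    finally have zw: "z1 - w = (\<mu> / r) *\<^sub>R z1" .
    have w_z1: "inner w z1 = \<tau> * r"
      using \<open>r > 0\<close> by (simp add: w_def r_def dot_square_norm power2_eq_square)
    have "(s - \<tau>) * (t - \<tau>) + inner (y - w) (z1 - w) \<le> 0" if "norm y \<le> s" for s y
    proof -
      \<comment> \<open>The terms free of \<open>s\<close> and \<open>y\<close> are \<tau> * \<mu>
        and its negative; they cancel because the residual is orthogonal to the candidate.\<close>
      have "(s - \<tau>) * (t - \<tau>) + inner (y - w) (z1 - w) = \<mu> / r * (inner y z1 - s * r)"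
        using \<open>r > 0\<close> by (simp add: t\<tau> zw inner_diff_left w_z1 field_simps)
      also have "\<dots> \<le> 0"
        using cs[OF that] \<open>\<mu> > 0\<close> \<open>r > 0\<close> by (intro mult_nonneg_nonpos) auto
      finally show ?thesis .
    qed
    moreover have "norm w \<le> \<tau>"
      using \<open>r > 0\<close> \<open>\<tau> > 0\<close> by (simp add: w_def r_def)
    ultimately show ?thesis
      using projI[of w \<tau>] 3 by (simp add: w_def divide_inverse mult.commute add.commute)
  qed
  then show ?thesis
    by (simp add: t_def r_def \<tau>_def Let_def)
qed

end
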